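(* BL-rings are closed under each of the following operations: 1. finite direct products: if $R_1,\dots,R_n$ are BL-rings, then $\prod_{k=1}^n R_k$ is a BL-ring; 2. arbitrary direct sums: if $(R_t)_{t\in T}$ is any family of BL-rings, then $\bigoplus_{t\in T}R_t$ is a BL-ring; 3. homomorphic images: if $R$ is a BL-ring and $S$ is a homomorphic image of $R$ (under a surjective ring homomorphism), then $S$ is a BL-ring.
   Context: Rings are commutative and are not assumed to have an identity. For ideals $I,J$ of a ring $R$, $I\cdot J$ is the usual product ideal and $I\to J:=\{x\in R: xI\subseteq J\}$. A commutative ring $R$ is called a BL-ring if for all ideals $I,J$ of $R$: (BLR-1) $I\cap J=I\cdot(I\to J)$, and (BLR-2) $(I\to J)+(J\to I)=R$. Direct sums are rings of finitely supported families, with componentwise operations. *)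

theory Defs
  imports "HOL-Algebra.Algebra"
begin

text \<open>
  Commutative rings that need not have an identity. The type of ring records of HOL-Algebra is
  reused, so that its additive notions and its sum and product of ideals are available.
  The field \<open>one\<close> of the record is never constrained nor used: its value is irrelevant and it need
  not even belong to the carrier.
\<close>

locale comm_rng = abelian_group R for R (structure) +
  assumes rng_m_closed: "\<lbrakk>x \<in> carrier R; y \<in> carrier R\<rbrakk> \<Longrightarrow> x \<otimes> y \<in> carrier R"
    and rng_m_assoc:
      "\<lbrakk>x \<in> carrier R; y \<in> carrier R; z \<in> carrier R\<rbrakk> \<Longrightarrow> (x \<otimes> y) \<otimes> z = x \<otimes> (y \<otimes> z)"
    and rng_m_comm: "\<lbrakk>x \<in> carrier R; y \<in> carrier R\<rbrakk> \<Longrightarrow> x \<otimes> y = y \<otimes> x"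
    and rng_l_distr:
      "\<lbrakk>x \<in> carrier R; y \<in> carrier R; z \<in> carrier R\<rbrakk> \<Longrightarrow> (x \<oplus> y) \<otimes> z = x \<otimes> z \<oplus> y \<otimes> z"

text \<open>The library locale \<open>ideal\<close> presupposes a ring with identity.\<close>

locale rng_ideal = additive_subgroup I R + comm_rng R for I and R (structure) +
  assumes rng_I_closed: "\<lbrakk>a \<in> I; x \<in> carrier R\<rbrakk> \<Longrightarrow> x \<otimes> a \<in> I"

lemma (in cring) comm_rng: "comm_rng R"
  by unfold_locales (simp_all add: m_assoc l_distr, simp add: m_comm)

lemma (in cring) rng_ideal_iff_ideal: "rng_ideal I R \<longleftrightarrow> ideal I R"
proof
  assume "rng_ideal I R"
  then interpret J: rng_ideal I R .
  show "ideal I R"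
    by unfold_locales (use J.rng_I_closed m_comm J.a_Hcarr in force)+
next
  assume "ideal I R"
  then interpret J: ideal I R .
  show "rng_ideal I R"
    by (intro rng_ideal.intro rng_ideal_axioms.intro comm_rng J.is_additive_subgroup J.I_l_closed)
qed

definition ideal_imp :: "('a, 'm) ring_scheme \<Rightarrow> 'a set \<Rightarrow> 'a set \<Rightarrow> 'a set"
  where "ideal_imp R I J = {x \<in> carrier R. \<forall>i\<in>I. x \<otimes>\<^bsub>R\<^esub> i \<in> J}"

text \<open>
  The library's \<open>ideal_prod\<close> consists of the nonempty finite sums of products \<open>i \<otimes> j\<close>. For ideals
  this is the usual product ideal also without an identity, since \<open>\<zero> = \<zero> \<otimes> \<zero>\<close> and
  \<open>\<ominus> (i \<otimes> j) = (\<ominus> i) \<otimes> j\<close>.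
\<close>

locale bl_ring = comm_rng R for R (structure) +
  assumes BLR_1: "\<lbrakk>rng_ideal I R; rng_ideal J R\<rbrakk> \<Longrightarrow> I \<inter> J = I \<cdot> ideal_imp R I J"
    and BLR_2: "\<lbrakk>rng_ideal I R; rng_ideal J R\<rbrakk> \<Longrightarrow> ideal_imp R I J <+>\<^bsub>R\<^esub> ideal_imp R J I = carrier R"

definition product_ring :: "'i set \<Rightarrow> ('i \<Rightarrow> ('a, 'm) ring_scheme) \<Rightarrow> ('i \<Rightarrow> 'a) ring"
  where "product_ring T R =
    \<lparr>carrier = (\<Pi>\<^sub>E t\<in>T. carrier (R t)),
     monoid.mult = (\<lambda>x y. \<lambda>t\<in>T. x t \<otimes>\<^bsub>R t\<^esub> y t),
     one = (\<lambda>t\<in>T. \<one>\<^bsub>R t\<^esub>),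
     ring.zero = (\<lambda>t\<in>T. \<zero>\<^bsub>R t\<^esub>),
     ring.add = (\<lambda>x y. \<lambda>t\<in>T. x t \<oplus>\<^bsub>R t\<^esub> y t)\<rparr>"

text \<open>For infinite \<open>T\<close> the field \<open>one\<close> of the following record lies outside the carrier in general.\<close>

definition direct_sum_ring :: "'i set \<Rightarrow> ('i \<Rightarrow> ('a, 'm) ring_scheme) \<Rightarrow> ('i \<Rightarrow> 'a) ring"
  where "direct_sum_ring T R =
    (product_ring T R)
      \<lparr>carrier := {x \<in> \<Pi>\<^sub>E t\<in>T. carrier (R t). finite {t \<in> T. x t \<noteq> \<zero>\<^bsub>R t\<^esub>}}\<rparr>"

text \<open>Additive and multiplicative maps; unlike for \<open>ring_hom\<close>, \<open>one\<close> need not be preserved.\<close>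

definition rng_hom :: "('a, 'm) ring_scheme \<Rightarrow> ('b, 'n) ring_scheme \<Rightarrow> ('a \<Rightarrow> 'b) set"
  where "rng_hom R S = hom (add_monoid R) (add_monoid S) \<inter> hom R S"

end

theory Submission
  imports Defs
begin

text \<open>
  For ideals \<open>I\<close>, \<open>J\<close> of a ring the inclusions \<open>I \<cdot> (I \<rightarrow> J) \<subseteq> I \<inter> J\<close> and
  \<open>(I \<rightarrow> J) + (J \<rightarrow> I) \<subseteq> R\<close> always hold, so being a BL-ring means that the left-hand sides, which are
  additive subgroups, are large enough (\<open>bl_ringI\<close>). Both homomorphic images and direct sums are
  additively generated by images of homomorphisms \<open>h\<close> from BL-rings: one surjection in the former case,
  the inclusions of the summands in the latter. It is therefore enough to push the two axioms
  forward along such an \<open>h\<close>, applied to the preimages \<open>h\<inverse> I\<close> and \<open>h\<inverse> J\<close>.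

  What has to be checked is that \<open>h\<close> maps \<open>h\<inverse> I \<rightarrow> h\<inverse> J\<close> into \<open>I \<rightarrow> J\<close>. This holds whenever a product
  \<open>h b \<otimes> y\<close> with \<open>y \<in> I\<close> can be rewritten as \<open>h (b \<otimes> a)\<close> with \<open>h a \<in> I\<close>; the locale
  \<open>ideal_absorbing_hom\<close> records this condition. For a surjection take \<open>a\<close> with \<open>h a = y\<close>. For the
  inclusion of the summand \<open>R t\<close> take \<open>a = y t\<close>. Now the inclusion must send \<open>y t\<close> back into \<open>I\<close>, which
  can fail for general rings without identity: an ideal of a direct sum need not be a direct sum
  of ideals. In a BL-ring, however, every element \<open>x\<close> has a local unit \<open>e\<close> with \<open>x \<otimes> e = x\<close>
  (\<open>local_unit\<close>), and multiplying \<open>y\<close> by the image of a local unit of \<open>y t\<close> isolates that component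
  inside \<open>I\<close>. For the same reason every element of \<open>I \<inter> J\<close> is a sum of elements of \<open>I \<inter> J\<close> that
  come from single summands, so the first axiom may be checked on these.

  A finite direct product is a direct sum, so it needs no separate argument.
\<close>

section \<open>Ideals in commutative rings without identity\<close>

context comm_rng
begin

lemma rng_r_distr:
  assumes "x \<in> carrier R" "y \<in> carrier R" "z \<in> carrier R"
  shows "x \<otimes> (y \<oplus> z) = x \<otimes> y \<oplus> x \<otimes> z"
  using assms by (metis add.m_closed rng_l_distr rng_m_comm)

lemma rng_l_null: "x \<in> carrier R \<Longrightarrow> \<zero> \<otimes> x = \<zero>"
  by (metis add.l_cancel_one' l_zero rng_l_distr rng_m_closed zero_closed)

lemma rng_r_null: "x \<in> carrier R \<Longrightarrow> x \<otimes> \<zero> = \<zero>"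
  by (metis rng_l_null rng_m_comm zero_closed)

lemma rng_l_minus:
  assumes "x \<in> carrier R" "y \<in> carrier R"
  shows "(\<ominus> x) \<otimes> y = \<ominus> (x \<otimes> y)"
proof (rule minus_equality [symmetric])
  show "\<ominus> x \<otimes> y \<oplus> x \<otimes> y = \<zero>"
    using assms by (metis a_inv_closed l_neg rng_l_distr rng_l_null)
qed (use assms rng_m_closed in auto)

lemma rng_r_minus:
  assumes "x \<in> carrier R" "y \<in> carrier R"
  shows "x \<otimes> (\<ominus> y) = \<ominus> (x \<otimes> y)"
  using assms by (metis a_inv_closed rng_l_minus rng_m_comm)

lemma additive_subgroupI:
  assumes "H \<subseteq> carrier R" "\<zero> \<in> H"
    and "\<And>x. x \<in> H \<Longrightarrow> \<ominus> x \<in> H"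
    and "\<And>x y. x \<in> H \<Longrightarrow> y \<in> H \<Longrightarrow> x \<oplus> y \<in> H"
  shows "additive_subgroup H R"
  using assms by (intro additive_subgroup.intro add.subgroupI) (auto simp: a_inv_def)

lemma rng_idealI:
  assumes "additive_subgroup I R"
    and "\<And>a x. a \<in> I \<Longrightarrow> x \<in> carrier R \<Longrightarrow> x \<otimes> a \<in> I"
  shows "rng_ideal I R"
  using assms by (intro rng_ideal.intro rng_ideal_axioms.intro comm_rng_axioms)

lemma rng_ideal_carrier: "rng_ideal (carrier R) R"
  by (intro rng_idealI additive_subgroupI) (auto simp: rng_m_closed)

lemma rng_ideal_multiples:
  assumes x: "x \<in> carrier R"
  shows "rng_ideal ((\<lambda>r. x \<otimes> r) ` carrier R) R" (is "rng_ideal ?M R")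
proof (intro rng_idealI additive_subgroupI)
  show "\<zero> \<in> ?M"
    using rng_r_null [OF x] by (metis image_eqI zero_closed)
next
  fix y assume "y \<in> ?M"
  then obtain r where "r \<in> carrier R" "y = x \<otimes> r" by blast
  then show "\<ominus> y \<in> ?M"
    using rng_r_minus [OF x] by (intro image_eqI [of _ _ "\<ominus> r"]) auto
next
  fix y z assume "y \<in> ?M" "z \<in> ?M"
  then obtain r s where "r \<in> carrier R" "y = x \<otimes> r" "s \<in> carrier R" "z = x \<otimes> s" by blast
  then show "y \<oplus> z \<in> ?M"
    using rng_r_distr [OF x] by (intro image_eqI [of _ _ "r \<oplus> s"]) auto
next
  fix y s assume "y \<in> ?M" and s: "s \<in> carrier R"
  then obtain r where "r \<in> carrier R" "y = x \<otimes> r" by blast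
  moreover from this have "s \<otimes> (x \<otimes> r) = x \<otimes> (r \<otimes> s)"
    using x s by (metis rng_m_assoc rng_m_closed rng_m_comm)
  ultimately show "s \<otimes> y \<in> ?M"
    using s by (simp add: rng_m_closed)
qed (auto simp: x rng_m_closed)

lemma rng_ideal_ideal_imp:
  assumes "rng_ideal I R" "rng_ideal J R"
  shows "rng_ideal (ideal_imp R I J) R"
proof -
  interpret I: rng_ideal I R by fact
  interpret J: rng_ideal J R by fact
  show ?thesis
  proof (intro rng_idealI additive_subgroupI)
    fix a x assume "a \<in> ideal_imp R I J" "x \<in> carrier R"
    then show "x \<otimes> a \<in> ideal_imp R I J"
      by (auto simp: ideal_imp_def rng_m_closed rng_m_assoc J.rng_I_closed)
  qed (auto simp: ideal_imp_def rng_l_null rng_l_minus rng_l_distr J.a_inv_closed J.a_closed)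
qed

lemma additive_subgroup_ideal_prod:
  assumes "rng_ideal I R" "rng_ideal J R"
  shows "additive_subgroup (I \<cdot> J) R"
proof -
  interpret I: rng_ideal I R by fact
  interpret J: rng_ideal J R by fact
  have closed: "x \<in> carrier R" if "x \<in> I \<cdot> J" for x
    using that by induction (auto simp: rng_m_closed)
  show ?thesis
  proof (rule additive_subgroupI)
    show "\<zero> \<in> I \<cdot> J"
      by (metis I.zero_closed J.zero_closed ideal_prod.prod rng_l_null zero_closed)
  next
    fix x assume "x \<in> I \<cdot> J"
    then show "\<ominus> x \<in> I \<cdot> J"
    proof induction
      case (prod i j)
      then have "\<ominus> (i \<otimes> j) = \<ominus> i \<otimes> j"
        by (simp add: rng_l_minus)
      then show ?case
        using prod by (simp add: ideal_prod.prod)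
    next
      case (sum s t)
      then have "\<ominus> (s \<oplus> t) = \<ominus> s \<oplus> \<ominus> t"
        by (simp add: closed minus_add)
      then show ?case
        using sum by (simp add: ideal_prod.sum)
    qed
  qed (auto intro: closed ideal_prod.sum)
qed

lemma additive_subgroup_set_add:
  assumes "additive_subgroup H R" "additive_subgroup K R"
  shows "additive_subgroup (H <+>\<^bsub>R\<^esub> K) R"
proof -
  interpret H: additive_subgroup H R by fact
  interpret K: additive_subgroup K R by fact
  show ?thesis
    using add.mult_subgroups [OF H.a_subgroup K.a_subgroup]
    by (simp add: additive_subgroup_def set_add_defs)
qed

lemma ideal_prod_ideal_imp_subset:
  assumes "rng_ideal I R" "rng_ideal J R"
  shows "I \<cdot> ideal_imp R I J \<subseteq> I \<inter> J"
proof
  interpret I: rng_ideal I R by fact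
  interpret J: rng_ideal J R by fact
  fix x assume "x \<in> I \<cdot> ideal_imp R I J"
  then show "x \<in> I \<inter> J"
  proof induction
    case (prod i j)
    then have "j \<in> carrier R" "j \<otimes> i \<in> J"
      by (auto simp: ideal_imp_def)
    then show ?case
      using prod I.rng_I_closed [of i j] by (simp add: rng_m_comm [of i j])
  qed auto
qed

lemma bl_ringI:
  assumes "\<And>I J. rng_ideal I R \<Longrightarrow> rng_ideal J R \<Longrightarrow> I \<inter> J \<subseteq> I \<cdot> ideal_imp R I J"
    and "\<And>I J. rng_ideal I R \<Longrightarrow> rng_ideal J R
      \<Longrightarrow> carrier R \<subseteq> ideal_imp R I J <+>\<^bsub>R\<^esub> ideal_imp R J I"
  shows "bl_ring R"
proof unfold_locales
  fix I J assume IJ: "rng_ideal I R" "rng_ideal J R"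
  show "I \<inter> J = I \<cdot> ideal_imp R I J"
    using assms(1) [OF IJ] ideal_prod_ideal_imp_subset [OF IJ] by blast
  have "ideal_imp R I J \<subseteq> carrier R" "ideal_imp R J I \<subseteq> carrier R"
    by (auto simp: ideal_imp_def)
  then show "ideal_imp R I J <+>\<^bsub>R\<^esub> ideal_imp R J I = carrier R"
    using assms(2) [OF IJ] by (meson set_add_closed subset_antisym)
qed

end

text \<open>
  Without an identity, \<open>x\<close> need not lie in \<open>x \<otimes> R\<close>. The largest ideal \<open>A\<close> with \<open>A \<otimes> R \<subseteq> x \<otimes> R\<close>
  does contain \<open>x\<close>, and the first axiom for \<open>I = J = A\<close> gives \<open>A = A \<cdot> (A \<rightarrow> A) \<subseteq> x \<otimes> R\<close>.
\<close>

lemma (in bl_ring) local_unit: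
  assumes x: "x \<in> carrier R"
  shows "\<exists>e\<in>carrier R. x \<otimes> e = x"
proof -
  let ?M = "(\<lambda>r. x \<otimes> r) ` carrier R"
  define A where "A = ideal_imp R (carrier R) ?M"
  interpret M: rng_ideal ?M R
    by (rule rng_ideal_multiples [OF x])
  have A: "rng_ideal A R"
    unfolding A_def by (intro rng_ideal_ideal_imp rng_ideal_carrier M.rng_ideal_axioms)
  have "x \<in> A"
    using x by (auto simp: A_def ideal_imp_def)
  then have "x \<in> A \<cdot> ideal_imp R A A"
    using BLR_1 [OF A A] by simp
  moreover have "y \<in> ?M" if "y \<in> A \<cdot> ideal_imp R A A" for y
    using that
  proof induction
    case (prod a b)
    then show ?case
      by (simp add: A_def ideal_imp_def)
  next
    case (sum y z)
    then show ?case
      by (intro M.a_closed)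
  qed
  ultimately show ?thesis
    by (metis (no_types, lifting) imageE)
qed

section \<open>Transport along homomorphisms\<close>

locale rng_hom_pair = R: comm_rng R + S: comm_rng S
  for R (structure) and S (structure) +
  fixes h
  assumes hom: "h \<in> rng_hom R S"
begin

lemma h_closed: "x \<in> carrier R \<Longrightarrow> h x \<in> carrier S"
  using hom by (auto simp: rng_hom_def hom_def)

lemma h_mult: "x \<in> carrier R \<Longrightarrow> y \<in> carrier R \<Longrightarrow> h (x \<otimes>\<^bsub>R\<^esub> y) = h x \<otimes>\<^bsub>S\<^esub> h y"
  using hom by (auto simp: rng_hom_def hom_def)

lemma h_add: "x \<in> carrier R \<Longrightarrow> y \<in> carrier R \<Longrightarrow> h (x \<oplus>\<^bsub>R\<^esub> y) = h x \<oplus>\<^bsub>S\<^esub> h y"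
  using hom by (auto simp: rng_hom_def hom_def)

lemma h_zero: "h \<zero>\<^bsub>R\<^esub> = \<zero>\<^bsub>S\<^esub>"
  by (metis R.l_zero R.zero_closed S.add.l_cancel_one' h_add h_closed)

lemma h_minus: "x \<in> carrier R \<Longrightarrow> h (\<ominus>\<^bsub>R\<^esub> x) = \<ominus>\<^bsub>S\<^esub> h x"
  by (metis R.a_inv_closed R.l_neg S.minus_equality h_add h_closed h_zero)

lemma rng_ideal_preimage:
  assumes "rng_ideal I S"
  shows "rng_ideal {x \<in> carrier R. h x \<in> I} R"
proof -
  interpret I: rng_ideal I S by fact
  show ?thesis
    by (intro R.rng_idealI R.additive_subgroupI)
      (auto simp: h_closed h_mult h_add h_zero h_minus R.rng_m_closed I.rng_I_closed)
qed

end

text \<open>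
  Common to surjections and to inclusions of summands of BL-rings; it makes the formation of
  \<open>I \<rightarrow> J\<close> compatible with preimages.
\<close>

locale ideal_absorbing_hom = rng_hom_pair R S h + R: bl_ring R
  for R (structure) and S (structure) and h +
  assumes absorb: "\<lbrakk>rng_ideal I S; y \<in> I; b \<in> carrier R\<rbrakk>
    \<Longrightarrow> \<exists>a\<in>carrier R. h a \<in> I \<and> h b \<otimes>\<^bsub>S\<^esub> y = h (b \<otimes>\<^bsub>R\<^esub> a)"
begin

lemma h_ideal_imp:
  assumes "rng_ideal I S"
    and "b \<in> ideal_imp R {x \<in> carrier R. h x \<in> I} {x \<in> carrier R. h x \<in> J}"
  shows "h b \<in> ideal_imp S I J"
proof -
  have "h b \<otimes>\<^bsub>S\<^esub> y \<in> J" if y: "y \<in> I" for y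
    using absorb [OF assms(1) y, of b] assms(2) by (auto simp: ideal_imp_def)
  then show ?thesis
    using assms(2) by (auto simp: ideal_imp_def h_closed)
qed

lemma image_in_ideal_prod:
  assumes I: "rng_ideal I S" and J: "rng_ideal J S"
    and x: "x \<in> carrier R" "h x \<in> I" "h x \<in> J"
  shows "h x \<in> I \<cdot>\<^bsub>S\<^esub> ideal_imp S I J"
proof -
  let ?I = "{x \<in> carrier R. h x \<in> I}" and ?J = "{x \<in> carrier R. h x \<in> J}"
  have "y \<in> carrier R \<and> h y \<in> I \<cdot>\<^bsub>S\<^esub> ideal_imp S I J" if "y \<in> ?I \<cdot>\<^bsub>R\<^esub> ideal_imp R ?I ?J" for y
    using that
  proof induction
    case (prod i j)
    then have "j \<in> carrier R" and "h j \<in> ideal_imp S I J"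
      using h_ideal_imp [OF I] by (auto simp: ideal_imp_def)
    then show ?case
      using prod by (auto simp: h_mult R.rng_m_closed intro: ideal_prod.prod)
  next
    case (sum s t)
    then show ?case
      by (auto simp: h_add intro: ideal_prod.sum)
  qed
  moreover have "x \<in> ?I \<cdot>\<^bsub>R\<^esub> ideal_imp R ?I ?J"
    using x R.BLR_1 [OF rng_ideal_preimage [OF I] rng_ideal_preimage [OF J]] by blast
  ultimately show ?thesis by blast
qed

lemma image_in_set_add:
  assumes I: "rng_ideal I S" and J: "rng_ideal J S" and x: "x \<in> carrier R"
  shows "h x \<in> ideal_imp S I J <+>\<^bsub>S\<^esub> ideal_imp S J I"
proof -
  let ?I = "{x \<in> carrier R. h x \<in> I}" and ?J = "{x \<in> carrier R. h x \<in> J}"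
  have "x \<in> ideal_imp R ?I ?J <+>\<^bsub>R\<^esub> ideal_imp R ?J ?I"
    using x R.BLR_2 [OF rng_ideal_preimage [OF I] rng_ideal_preimage [OF J]] by blast
  then obtain a b where ab: "a \<in> ideal_imp R ?I ?J" "b \<in> ideal_imp R ?J ?I" "x = a \<oplus>\<^bsub>R\<^esub> b"
    unfolding set_add_def' by blast
  then have "h x = h a \<oplus>\<^bsub>S\<^esub> h b"
    by (auto simp: ideal_imp_def h_add)
  then show ?thesis
    using h_ideal_imp [OF I ab(1)] h_ideal_imp [OF J ab(2)] unfolding set_add_def' by blast
qed

end

lemma bl_ring_hom_image:
  assumes "bl_ring R" "comm_rng S" "h \<in> rng_hom R S" and onto: "h ` carrier R = carrier S"
  shows "bl_ring S"
proof -
  interpret R: bl_ring R by fact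
  interpret S: comm_rng S by fact
  interpret rng_hom_pair R S h
    by unfold_locales fact
  interpret ideal_absorbing_hom R S h
  proof
    fix I y b assume "rng_ideal I S" and y: "y \<in> I" and b: "b \<in> carrier R"
    interpret I: rng_ideal I S by fact
    have "y \<in> h ` carrier R"
      using y onto by simp
    then obtain a where "a \<in> carrier R" "y = h a" by blast
    then show "\<exists>a\<in>carrier R. h a \<in> I \<and> h b \<otimes>\<^bsub>S\<^esub> y = h (b \<otimes>\<^bsub>R\<^esub> a)"
      using b y h_mult by auto
  qed
  show ?thesis
  proof (rule S.bl_ringI)
    fix I J assume I: "rng_ideal I S" and J: "rng_ideal J S"
    interpret I: rng_ideal I S by fact
    show "carrier S \<subseteq> ideal_imp S I J <+>\<^bsub>S\<^esub> ideal_imp S J I"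
      unfolding onto [symmetric] by (intro image_subsetI image_in_set_add I J)
    show "I \<inter> J \<subseteq> I \<cdot>\<^bsub>S\<^esub> ideal_imp S I J"
    proof
      fix y assume y: "y \<in> I \<inter> J"
      then have "y \<in> h ` carrier R"
        using I.a_Hcarr onto by simp
      then show "y \<in> I \<cdot>\<^bsub>S\<^esub> ideal_imp S I J"
        using y image_in_ideal_prod [OF I J] by auto
    qed
  qed
qed

section \<open>Direct sums\<close>

locale comm_rng_family =
  fixes T :: "'i set" and R :: "'i \<Rightarrow> ('a, 'm) ring_scheme"
  assumes comm_rng_component: "t \<in> T \<Longrightarrow> comm_rng (R t)"
begin

abbreviation D :: "('i \<Rightarrow> 'a) ring" where "D \<equiv> direct_sum_ring T R"

lemma D_carrier:
  "x \<in> carrier D \<longleftrightarrow> x \<in> (\<Pi>\<^sub>E t\<in>T. carrier (R t)) \<and> finite {t \<in> T. x t \<noteq> \<zero>\<^bsub>R t\<^esub>}"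
  by (simp add: direct_sum_ring_def)

lemma D_component: "x \<in> carrier D \<Longrightarrow> t \<in> T \<Longrightarrow> x t \<in> carrier (R t)"
  by (auto simp: D_carrier)

lemma D_carrierI:
  assumes "\<And>t. t \<in> T \<Longrightarrow> x t \<in> carrier (R t)" "x \<in> extensional T"
    and "finite F" "\<And>t. t \<in> T \<Longrightarrow> t \<notin> F \<Longrightarrow> x t = \<zero>\<^bsub>R t\<^esub>"
  shows "x \<in> carrier D"
  unfolding D_carrier
proof
  show "x \<in> (\<Pi>\<^sub>E t\<in>T. carrier (R t))"
    using assms by (simp add: PiE_iff)
  show "finite {t \<in> T. x t \<noteq> \<zero>\<^bsub>R t\<^esub>}"
    using assms by (auto intro: finite_subset [of _ F])
qed

lemma D_ops:
  "x \<otimes>\<^bsub>D\<^esub> y = (\<lambda>t\<in>T. x t \<otimes>\<^bsub>R t\<^esub> y t)"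
  "x \<oplus>\<^bsub>D\<^esub> y = (\<lambda>t\<in>T. x t \<oplus>\<^bsub>R t\<^esub> y t)"
  "\<zero>\<^bsub>D\<^esub> = (\<lambda>t\<in>T. \<zero>\<^bsub>R t\<^esub>)"
  by (simp_all add: direct_sum_ring_def product_ring_def)

lemma D_eqI:
  assumes "x \<in> carrier D" "y \<in> carrier D" "\<And>t. t \<in> T \<Longrightarrow> x t = y t"
  shows "x = y"
  using assms unfolding D_carrier by (meson PiE_ext)

lemma abelian_group_component: "t \<in> T \<Longrightarrow> abelian_group (R t)"
  using comm_rng_component comm_rng.axioms(1) by blast

lemma D_add_closed:
  assumes x: "x \<in> carrier D" and y: "y \<in> carrier D"
  shows "x \<oplus>\<^bsub>D\<^esub> y \<in> carrier D"
proof (rule D_carrierI)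
  show "finite ({t \<in> T. x t \<noteq> \<zero>\<^bsub>R t\<^esub>} \<union> {t \<in> T. y t \<noteq> \<zero>\<^bsub>R t\<^esub>})"
    using x y by (simp add: D_carrier)
next
  fix t assume t: "t \<in> T"
  interpret Rt: comm_rng "R t" by (rule comm_rng_component [OF t])
  show "(x \<oplus>\<^bsub>D\<^esub> y) t \<in> carrier (R t)"
    using t D_component x y by (simp add: D_ops)
  assume "t \<notin> {t \<in> T. x t \<noteq> \<zero>\<^bsub>R t\<^esub>} \<union> {t \<in> T. y t \<noteq> \<zero>\<^bsub>R t\<^esub>}"
  then show "(x \<oplus>\<^bsub>D\<^esub> y) t = \<zero>\<^bsub>R t\<^esub>"
    using t by (simp add: D_ops)
qed (simp add: D_ops)

lemma D_mult_closed:
  assumes x: "x \<in> carrier D" and y: "y \<in> carrier D"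
  shows "x \<otimes>\<^bsub>D\<^esub> y \<in> carrier D"
proof (rule D_carrierI)
  show "finite {t \<in> T. x t \<noteq> \<zero>\<^bsub>R t\<^esub>}"
    using x by (simp add: D_carrier)
next
  fix t assume t: "t \<in> T"
  interpret Rt: comm_rng "R t" by (rule comm_rng_component [OF t])
  show "(x \<otimes>\<^bsub>D\<^esub> y) t \<in> carrier (R t)"
    using t D_component x y by (simp add: D_ops Rt.rng_m_closed)
  assume "t \<notin> {t \<in> T. x t \<noteq> \<zero>\<^bsub>R t\<^esub>}"
  then show "(x \<otimes>\<^bsub>D\<^esub> y) t = \<zero>\<^bsub>R t\<^esub>"
    using t D_component [OF y] by (simp add: D_ops Rt.rng_l_null)
qed (simp add: D_ops)

lemma D_zero_closed: "\<zero>\<^bsub>D\<^esub> \<in> carrier D"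
  by (rule D_carrierI [of _ "{}"])
    (auto simp: D_ops abelian_group_component abelian_groupE(2))

lemma comm_rng_direct_sum: "comm_rng D"
proof (intro comm_rng.intro abelian_groupI comm_rng_axioms.intro)
  note clos = D_add_closed D_mult_closed D_zero_closed
  show "\<exists>y\<in>carrier D. y \<oplus>\<^bsub>D\<^esub> x = \<zero>\<^bsub>D\<^esub>" if x: "x \<in> carrier D" for x
  proof
    let ?y = "\<lambda>t\<in>T. \<ominus>\<^bsub>R t\<^esub> x t"
    show y: "?y \<in> carrier D"
    proof (rule D_carrierI)
      show "finite {t \<in> T. x t \<noteq> \<zero>\<^bsub>R t\<^esub>}"
        using x by (simp add: D_carrier)
    next
      fix t assume t: "t \<in> T"
      interpret Rt: comm_rng "R t" by (rule comm_rng_component [OF t])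
      show "?y t \<in> carrier (R t)"
        using t D_component x by simp
      assume "t \<notin> {t \<in> T. x t \<noteq> \<zero>\<^bsub>R t\<^esub>}"
      then show "?y t = \<zero>\<^bsub>R t\<^esub>"
        using t by simp
    qed simp
    show "?y \<oplus>\<^bsub>D\<^esub> x = \<zero>\<^bsub>D\<^esub>"
      by (rule D_eqI) (auto simp: clos x y, auto simp: D_ops D_component [OF x]
          abelian_group.l_neg [OF abelian_group_component])
  qed
  fix x y z assume x: "x \<in> carrier D" and y: "y \<in> carrier D" and z: "z \<in> carrier D"
  note xyz = x y z D_component [OF x] D_component [OF y] D_component [OF z]
  show "x \<oplus>\<^bsub>D\<^esub> y \<oplus>\<^bsub>D\<^esub> z = x \<oplus>\<^bsub>D\<^esub> (y \<oplus>\<^bsub>D\<^esub> z)"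
    by (rule D_eqI) (auto simp: clos xyz, auto simp: D_ops xyz
        abelian_groupE(3) [OF abelian_group_component])
  show "x \<otimes>\<^bsub>D\<^esub> y \<otimes>\<^bsub>D\<^esub> z = x \<otimes>\<^bsub>D\<^esub> (y \<otimes>\<^bsub>D\<^esub> z)"
    by (rule D_eqI) (auto simp: clos xyz, auto simp: D_ops xyz
        comm_rng.rng_m_assoc [OF comm_rng_component])
  show "(x \<oplus>\<^bsub>D\<^esub> y) \<otimes>\<^bsub>D\<^esub> z = x \<otimes>\<^bsub>D\<^esub> z \<oplus>\<^bsub>D\<^esub> y \<otimes>\<^bsub>D\<^esub> z"
    by (rule D_eqI) (auto simp: clos xyz, auto simp: D_ops xyz
        comm_rng.rng_l_distr [OF comm_rng_component])
next
  note clos = D_add_closed D_mult_closed D_zero_closed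
  fix x y assume x: "x \<in> carrier D" and y: "y \<in> carrier D"
  note xy = x y D_component [OF x] D_component [OF y]
  show "x \<oplus>\<^bsub>D\<^esub> y = y \<oplus>\<^bsub>D\<^esub> x"
    by (rule D_eqI) (auto simp: clos xy, auto simp: D_ops xy
        abelian_groupE(4) [OF abelian_group_component])
  show "x \<otimes>\<^bsub>D\<^esub> y = y \<otimes>\<^bsub>D\<^esub> x"
    by (rule D_eqI) (auto simp: clos xy, auto simp: D_ops xy
        comm_rng.rng_m_comm [OF comm_rng_component])
  show "\<zero>\<^bsub>D\<^esub> \<oplus>\<^bsub>D\<^esub> x = x"
    by (rule D_eqI) (auto simp: clos xy, auto simp: D_ops xy
        abelian_groupE(5) [OF abelian_group_component])
qed (auto simp: D_add_closed D_mult_closed D_zero_closed)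

definition inject :: "'i \<Rightarrow> 'a \<Rightarrow> 'i \<Rightarrow> 'a"
  where "inject t a = (\<lambda>s\<in>T. if s = t then a else \<zero>\<^bsub>R s\<^esub>)"

lemma inject_closed:
  assumes "t \<in> T" "a \<in> carrier (R t)"
  shows "inject t a \<in> carrier D"
  using assms by (intro D_carrierI [of _ "{t}"])
    (auto simp: inject_def abelian_group_component abelian_groupE(2))

lemma inject_mult:
  assumes t: "t \<in> T" and b: "b \<in> carrier (R t)" and y: "y \<in> carrier D"
  shows "inject t b \<otimes>\<^bsub>D\<^esub> y = inject t (b \<otimes>\<^bsub>R t\<^esub> y t)"
  using t by (auto simp: D_ops inject_def fun_eq_iff comm_rng.rng_l_null [OF comm_rng_component]
      D_component [OF y])

lemma inject_rng_hom:
  assumes t: "t \<in> T"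
  shows "inject t \<in> rng_hom (R t) D"
proof -
  have "inject t (x \<oplus>\<^bsub>R t\<^esub> y) = inject t x \<oplus>\<^bsub>D\<^esub> inject t y"
    if "x \<in> carrier (R t)" "y \<in> carrier (R t)" for x y
    using t that by (auto simp: D_ops inject_def fun_eq_iff abelian_groupE(2,5) abelian_group_component)
  moreover have "inject t (x \<otimes>\<^bsub>R t\<^esub> y) = inject t x \<otimes>\<^bsub>D\<^esub> inject t y"
    if "x \<in> carrier (R t)" "y \<in> carrier (R t)" for x y
    using inject_mult [OF t that(1) inject_closed [OF t that(2)]] t by (simp add: inject_def)
  ultimately show ?thesis
    using inject_closed [OF t] by (auto simp: rng_hom_def hom_def)
qed

text \<open>
  An element of a direct sum is the finite sum of its injected components. This reduces membership in
  a product or sum of ideals to membership of elements that come from a single summand.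
\<close>

lemma additive_subgroup_contains:
  assumes "additive_subgroup H D" and x: "x \<in> carrier D"
    and comp: "\<And>t. t \<in> T \<Longrightarrow> inject t (x t) \<in> H"
  shows "x \<in> H"
proof -
  interpret H: additive_subgroup H D by fact
  define cut where "cut F = (\<lambda>s\<in>T. if s \<in> F then x s else \<zero>\<^bsub>R s\<^esub>)" for F
  have "cut F \<in> H" if "finite F" "F \<subseteq> T" for F
    using that
  proof (induction F rule: finite_induct)
    case empty
    have "cut {} = \<zero>\<^bsub>D\<^esub>"
      by (auto simp: D_ops cut_def)
    then show ?case
      by simp
  next
    case (insert t F)
    have "cut (insert t F) = inject t (x t) \<oplus>\<^bsub>D\<^esub> cut F"
    proof
      fix s
      show "cut (insert t F) s = (inject t (x t) \<oplus>\<^bsub>D\<^esub> cut F) s"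
      proof (cases "s \<in> T")
        case True
        interpret Rs: comm_rng "R s" by (rule comm_rng_component [OF True])
        have "x s \<in> carrier (R s)"
          by (rule D_component [OF x True])
        then have "x s \<oplus>\<^bsub>R s\<^esub> \<zero>\<^bsub>R s\<^esub> = x s" "\<zero>\<^bsub>R s\<^esub> \<oplus>\<^bsub>R s\<^esub> x s = x s" "\<zero>\<^bsub>R s\<^esub> \<oplus>\<^bsub>R s\<^esub> \<zero>\<^bsub>R s\<^esub> = \<zero>\<^bsub>R s\<^esub>"
          by simp_all
        then show ?thesis
          using True insert.hyps(2) by (cases "s = t") (simp_all add: D_ops inject_def cut_def)
      qed (simp add: D_ops cut_def)
    qed
    then show ?case
      using insert comp by simp
  qed
  from this [of "{t \<in> T. x t \<noteq> \<zero>\<^bsub>R t\<^esub>}"]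
  have "cut {t \<in> T. x t \<noteq> \<zero>\<^bsub>R t\<^esub>} \<in> H"
    using x by (simp add: D_carrier)
  moreover have "cut {t \<in> T. x t \<noteq> \<zero>\<^bsub>R t\<^esub>} = x"
  proof
    fix s
    show "cut {t \<in> T. x t \<noteq> \<zero>\<^bsub>R t\<^esub>} s = x s"
    proof (cases "s \<in> T")
      case False
      then have "x s = undefined"
        using x PiE_arb [of x T _ s] unfolding D_carrier by blast
      then show ?thesis
        using False by (simp add: cut_def)
    qed (simp add: cut_def)
  qed
  ultimately show ?thesis by simp
qed

end

lemma bl_ring_direct_sum:
  assumes bl: "\<And>t. t \<in> T \<Longrightarrow> bl_ring (R t)"
  shows "bl_ring (direct_sum_ring T R)"
proof -
  interpret comm_rng_family T R
    by (intro comm_rng_family.intro bl_ring.axioms(1) bl)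
  interpret D: comm_rng D
    by (rule comm_rng_direct_sum)
  \<comment> \<open>ideals contain the components of their elements, because the component rings have local units\<close>
  have component: "inject t (y t) \<in> I" if t: "t \<in> T" and "rng_ideal I D" and y: "y \<in> I" for t I y
  proof -
    interpret Rt: bl_ring "R t" by (rule bl [OF t])
    interpret I: rng_ideal I D by fact
    have yt: "y t \<in> carrier (R t)"
      using y D_component t by simp
    then obtain e where e: "e \<in> carrier (R t)" "y t \<otimes>\<^bsub>R t\<^esub> e = y t"
      using Rt.local_unit by blast
    then have "inject t e \<otimes>\<^bsub>D\<^esub> y = inject t (y t)"
      using inject_mult [OF t e(1), of y] y yt by (simp add: Rt.rng_m_comm)
    then show ?thesis
      using I.rng_I_closed [OF y inject_closed [OF t e(1)]] by simp
  qed
  have absorbing: "ideal_absorbing_hom (R t) D (inject t)" if t: "t \<in> T" for t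
  proof -
    interpret Rt: bl_ring "R t" by (rule bl [OF t])
    show ?thesis
    proof unfold_locales
      show "inject t \<in> rng_hom (R t) D"
        by (rule inject_rng_hom [OF t])
      fix I y b assume I: "rng_ideal I D" and y: "y \<in> I" and b: "b \<in> carrier (R t)"
      interpret I: rng_ideal I D by fact
      show "\<exists>a\<in>carrier (R t). inject t a \<in> I \<and> inject t b \<otimes>\<^bsub>D\<^esub> y = inject t (b \<otimes>\<^bsub>R t\<^esub> a)"
        using component [OF t I y] inject_mult [OF t b] D_component [OF _ t] y
        by (intro bexI [of _ "y t"]) auto
    qed
  qed
  show ?thesis
  proof (rule D.bl_ringI)
    fix I J assume I: "rng_ideal I D" and J: "rng_ideal J D"
    interpret I: rng_ideal I D by fact
    note imp = D.rng_ideal_ideal_imp [OF I J] D.rng_ideal_ideal_imp [OF J I]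
    show "I \<inter> J \<subseteq> I \<cdot>\<^bsub>D\<^esub> ideal_imp D I J"
    proof
      fix x assume x: "x \<in> I \<inter> J"
      show "x \<in> I \<cdot>\<^bsub>D\<^esub> ideal_imp D I J"
      proof (rule additive_subgroup_contains [OF D.additive_subgroup_ideal_prod [OF I imp(1)]])
        fix t assume t: "t \<in> T"
        show "inject t (x t) \<in> I \<cdot>\<^bsub>D\<^esub> ideal_imp D I J"
          using ideal_absorbing_hom.image_in_ideal_prod [OF absorbing [OF t] I J]
            component [OF t I] component [OF t J] x D_component [OF _ t] by simp
      qed (use x in simp)
    qed
    show "carrier D \<subseteq> ideal_imp D I J <+>\<^bsub>D\<^esub> ideal_imp D J I"
    proof
      fix x assume x: "x \<in> carrier D"
      have "additive_subgroup (ideal_imp D I J <+>\<^bsub>D\<^esub> ideal_imp D J I) D"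
        using imp [THEN rng_ideal.axioms(1)] by (rule D.additive_subgroup_set_add)
      then show "x \<in> ideal_imp D I J <+>\<^bsub>D\<^esub> ideal_imp D J I"
      proof (rule additive_subgroup_contains [OF _ x])
        fix t assume t: "t \<in> T"
        show "inject t (x t) \<in> ideal_imp D I J <+>\<^bsub>D\<^esub> ideal_imp D J I"
          by (rule ideal_absorbing_hom.image_in_set_add [OF absorbing [OF t] I J D_component [OF x t]])
      qed
    qed
  qed
qed

lemma direct_sum_ring_finite:
  assumes "finite T"
  shows "direct_sum_ring T R = product_ring T R"
  using assms by (simp add: direct_sum_ring_def product_ring_def)

theorem proposition2p12:
  shows "(\<forall>(n::nat) (R :: nat \<Rightarrow> ('a, 'm) ring_scheme).
            (\<forall>k\<in>{1..n}. bl_ring (R k)) \<longrightarrow> bl_ring (product_ring {1..n} R))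
       \<and> (\<forall>(T :: 'i set) (R :: 'i \<Rightarrow> ('b, 'n) ring_scheme).
            (\<forall>t\<in>T. bl_ring (R t)) \<longrightarrow> bl_ring (direct_sum_ring T R))
       \<and> (\<forall>(R :: ('c, 'p) ring_scheme) (S :: ('d, 'q) ring_scheme) h.
            bl_ring R \<and> comm_rng S \<and> h \<in> rng_hom R S \<and> h ` carrier R = carrier S
              \<longrightarrow> bl_ring S)"
proof (intro conjI allI impI)
  fix n :: nat and R :: "nat \<Rightarrow> ('a, 'm) ring_scheme"
  assume "\<forall>k\<in>{1..n}. bl_ring (R k)"
  then have "bl_ring (direct_sum_ring {1..n} R)"
    by (intro bl_ring_direct_sum) blast
  then show "bl_ring (product_ring {1..n} R)"
    by (simp only: direct_sum_ring_finite finite_atLeastAtMost)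
next
  fix T :: "'i set" and R :: "'i \<Rightarrow> ('b, 'n) ring_scheme"
  assume "\<forall>t\<in>T. bl_ring (R t)"
  then show "bl_ring (direct_sum_ring T R)"
    by (intro bl_ring_direct_sum) blast
next
  fix R :: "('c, 'p) ring_scheme" and S :: "('d, 'q) ring_scheme" and h
  assume "bl_ring R \<and> comm_rng S \<and> h \<in> rng_hom R S \<and> h ` carrier R = carrier S"
  then show "bl_ring S"
    using bl_ring_hom_image [of R S h] by simp
qed

end
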